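(* Let $P$ be a simple polytope, and let $\mathcal{O}$ be an acyclic orientation of $\mathcal{G}_P$. If $\mathcal{O}$ induces precisely one sink on every $2$-face of $P$, then $\mathcal{O}$ is an AOF-orientation.
   Context: A $d$-polytope $P$ is simple if every vertex of $P$ is contained in exactly $d$ edges. $\mathcal{G}_P$ denotes the abstract vertex-edge graph of $P$. A $2$-face is a $2$-dimensional face; $P$ itself counts as a face of $P$. An orientation is acyclic if it has no directed cycles. A sink induced by $\mathcal{O}$ on a face $F$ is a vertex of $F$ all of whose incident edges in the subgraph of $\mathcal{G}_P$ induced by the vertices of $F$ are directed towards it. An AOF-orientation of $\mathcal{G}_P$ is an acyclic orientation of $\mathcal{G}_P$ that induces a unique sink on every non-empty face of $P$ (including $P$ itself). *)

theory Defs
  imports "HOL-Analysis.Analysis"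
begin

definition vertices_of :: "'a::euclidean_space set \<Rightarrow> 'a set" where
  "vertices_of P = {v. v extreme_point_of P}"

text \<open>The graph of a polytope has vertex set \<open>vertices_of P\<close>; its edges are two-element vertex sets.
  A degenerate segment has affine dimension 0, so no loops occur, and the endpoints of a segment
  that is a face of \<open>P\<close> are automatically extreme points of \<open>P\<close>.\<close>

definition graph_edges :: "'a::euclidean_space set \<Rightarrow> 'a set set" where
  "graph_edges P = {{u, v} | u v. closed_segment u v edge_of P}"

text \<open>The dimension \<open>d\<close> is that of the polytope itself, not of the ambient space.\<close>

definition simple_polytope :: "'a::euclidean_space set \<Rightarrow> bool" where
  "simple_polytope P \<longleftrightarrow>
     polytope P \<and>
     (\<forall>v \<in> vertices_of P. int (card {e. e edge_of P \<and> v \<in> e}) = aff_dim P)"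

text \<open>A pair \<open>(u, v)\<close> in an orientation is the edge \<open>{u, v}\<close> directed from \<open>u\<close> towards \<open>v\<close>.\<close>

definition orientation_of :: "'a set set \<Rightarrow> ('a \<times> 'a) set \<Rightarrow> bool" where
  "orientation_of E D \<longleftrightarrow>
     (\<forall>(u, v) \<in> D. {u, v} \<in> E) \<and>
     (\<forall>u v. {u, v} \<in> E \<longrightarrow> ((u, v) \<in> D \<longleftrightarrow> (v, u) \<notin> D))"

definition acyclic_orientation :: "'a::euclidean_space set \<Rightarrow> ('a \<times> 'a) set \<Rightarrow> bool" where
  "acyclic_orientation P D \<longleftrightarrow> orientation_of (graph_edges P) D \<and> acyclic D"

definition induced_edges :: "'a set set \<Rightarrow> 'a set \<Rightarrow> 'a set set" where
  "induced_edges E W = {e \<in> E. e \<subseteq> W}"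

definition sink_on ::
  "'a::euclidean_space set \<Rightarrow> ('a \<times> 'a) set \<Rightarrow> 'a set \<Rightarrow> 'a \<Rightarrow> bool" where
  "sink_on P D F v \<longleftrightarrow>
     v \<in> vertices_of F \<and>
     (\<forall>u. {u, v} \<in> induced_edges (graph_edges P) (vertices_of F) \<longrightarrow> (u, v) \<in> D)"

definition AOF_orientation :: "'a::euclidean_space set \<Rightarrow> ('a \<times> 'a) set \<Rightarrow> bool" where
  "AOF_orientation P D \<longleftrightarrow>
     acyclic_orientation P D \<and>
     (\<forall>F. F face_of P \<and> F \<noteq> {} \<longrightarrow> (\<exists>!v. sink_on P D F v))"

end

theory Submission
  imports Defs
begin

text \<open>Two sinks \<open>s\<close>, \<open>t\<close> of a face \<open>F\<close> are joined by a walk in the graph of \<open>F\<close>. Rank the vertices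
  compatibly with the orientation. At a lowest vertex \<open>w\<close> of the walk both walk edges leave \<open>w\<close>;
  by simplicity they span a 2-face of \<open>F\<close>, and following the orientation inside this 2-face
  from the two neighbours leads to its unique sink, so \<open>w\<close> can be bypassed through higher vertices.
  Hence \<open>s\<close> and \<open>t\<close> are joined by a walk that never goes below the lower of the two, but every
  neighbour of a sink is lower than it, so \<open>s = t\<close>.

  Connectedness and the 2-faces both come from one geometric fact: seen from a vertex, a polytope
  lies in the cone generated by its edges at that vertex.\<close>

section \<open>Faces, slices and the edge cone of a polytope at a vertex\<close>

text \<open>The smallest face through \<open>x\<close> works: were \<open>x\<close> on its relative
  boundary, a facet of it would be a still smaller face through \<open>x\<close>.\<close>

lemma polyhedron_face_rel_interior:
  fixes Q :: "'a::euclidean_space set"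
  assumes Q: "polyhedron Q" and x: "x \<in> Q"
  obtains G where "G face_of Q" "x \<in> rel_interior G"
proof -
  define G where "G = \<Inter>{F. F face_of Q \<and> x \<in> F}"
  have QQ: "Q \<in> {F. F face_of Q \<and> x \<in> F}"
    using x Q by (simp add: face_of_refl polyhedron_imp_convex)
  have G: "G face_of Q"
    unfolding G_def by (rule face_of_Inter) (use QQ in blast)+
  have xG: "x \<in> G"
    by (simp add: G_def)
  have "x \<in> rel_interior G"
  proof (rule ccontr)
    assume "x \<notin> rel_interior G"
    then obtain F where F: "F facet_of G" "x \<in> F"
      using rel_boundary_of_polyhedron[of G] face_of_polyhedron_polyhedron[OF Q G] xG by blast
    then have "F face_of Q"
      using G face_of_trans facet_of_imp_face_of by blast
    then have "G \<subseteq> F"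
      using F(2) by (auto simp: G_def)
    then have "F = G"
      using facet_of_imp_subset[OF F(1)] by (rule subset_antisym[rotated])
    then show False
      using F(1) by simp
  qed
  with G that show ?thesis by blast
qed

text \<open>If \<open>G\<close> had dimension at least 2, the hyperplane section of its affine hull
  would contain a line through \<open>x\<close>. Since \<open>x\<close> is a relative interior
  point, a short segment of that line centred at \<open>x\<close> stays in the slice, so
  \<open>x\<close> is not extreme.\<close>

lemma extreme_point_of_slice_aff_dim:
  fixes G :: "'a::euclidean_space set"
  assumes x: "x extreme_point_of G \<inter> {y. a \<bullet> y = b}" and xG: "x \<in> rel_interior G"
  shows "aff_dim G \<le> 1"
proof (rule ccontr)
  assume "\<not> aff_dim G \<le> 1"
  define A where "A = affine hull G \<inter> {y. a \<bullet> y = b}"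
  have affA: "affine A"
    unfolding A_def by (intro affine_Int affine_affine_hull affine_hyperplane)
  have xA: "x \<in> A"
    using x by (auto simp: A_def extreme_point_of_def hull_inc)
  then have "aff_dim A \<ge> 1"
    using \<open>\<not> aff_dim G \<le> 1\<close> aff_dim_affine_Int_hyperplane[of "affine hull G" a b]
    by (auto simp: A_def split: if_splits)
  then have "A \<noteq> {x}"
    by auto
  then obtain y where y: "y \<in> A" "y \<noteq> x"
    using xA by blast
  obtain e where e: "e > 0" "ball x e \<inter> affine hull G \<subseteq> G"
    using xG mem_rel_interior_ball by blast
  \<comment> \<open>Moving by \<open>d\<close> along \<open>y - x\<close> covers the distance
    \<open>e / 2\<close>, so both ends of the segment centred at \<open>x\<close> stay in the
    ball.\<close>
  define d where "d = e / (2 * norm (y - x))"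
  have "d > 0"
    using e y by (simp add: d_def)
  have nd: "norm (d *\<^sub>R (y - x)) < e"
    using e y by (simp add: d_def)
  have *: "x + c *\<^sub>R (y - x) \<in> G \<inter> {y. a \<bullet> y = b}" if "\<bar>c\<bar> = d" for c
  proof -
    have "x + c *\<^sub>R (y - x) = (1 - c) *\<^sub>R x + c *\<^sub>R y"
      by (simp add: algebra_simps)
    then have "x + c *\<^sub>R (y - x) \<in> A"
      using affA xA y by (simp add: affine_alt)
    moreover have "norm (c *\<^sub>R (y - x)) < e"
      using nd that \<open>d > 0\<close> by simp
    then have "x + c *\<^sub>R (y - x) \<in> ball x e"
      by (simp add: dist_norm norm_minus_commute)
    ultimately show ?thesis
      using e(2) by (auto simp: A_def)
  qed
  have "x \<in> open_segment (x + d *\<^sub>R (y - x)) (x + (- d) *\<^sub>R (y - x))"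
    unfolding in_segment
  proof (intro conjI exI[of _ "1/2"])
    show "x + d *\<^sub>R (y - x) \<noteq> x + (- d) *\<^sub>R (y - x)"
    proof
      assume "x + d *\<^sub>R (y - x) = x + (- d) *\<^sub>R (y - x)"
      then have "d *\<^sub>R (y - x) + d *\<^sub>R (y - x) = 0"
        by (simp only: add_left_cancel scaleR_minus_left eq_neg_iff_add_eq_0)
      then have "2 *\<^sub>R (d *\<^sub>R (y - x)) = 0"
        by (simp only: scaleR_2)
      then show False
        using \<open>d > 0\<close> y by simp
    qed
    have "(1 / 2 :: real) *\<^sub>R (p + q) + (1 / 2) *\<^sub>R (p - q) = p" for p q :: 'a
      by (simp add: algebra_simps flip: scaleR_2 scaleR_add_left)
    from this[of x "d *\<^sub>R (y - x)"]
    show "x = (1 - 1 / 2) *\<^sub>R (x + d *\<^sub>R (y - x)) + (1 / 2) *\<^sub>R (x + (- d) *\<^sub>R (y - x))"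
      by simp
  qed auto
  moreover have "x + d *\<^sub>R (y - x) \<in> G \<inter> {y. a \<bullet> y = b}"
    "x + (- d) *\<^sub>R (y - x) \<in> G \<inter> {y. a \<bullet> y = b}"
    using *[of d] *[of "- d"] \<open>d > 0\<close> by auto
  ultimately show False
    using x unfolding extreme_point_of_def by blast
qed

lemma edge_of_eq_segment:
  fixes Q :: "'a::euclidean_space set"
  assumes "polytope Q" "e edge_of Q"
  obtains u v where "u \<noteq> v" "e = closed_segment u v"
proof -
  have e: "e face_of Q" "aff_dim e = 1"
    using assms by (auto simp: edge_of_def)
  then have "polytope e"
    using assms face_of_polytope_polytope by blast
  moreover have "collinear e" "e \<noteq> {}"
    using e by (auto simp: collinear_aff_dim)
  ultimately obtain u v where uv: "e = closed_segment u v"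
    by (metis compact_convex_collinear_segment polytope_imp_compact polytope_imp_convex)
  moreover have "u \<noteq> v"
    using uv e by auto
  ultimately show ?thesis
    using that by blast
qed

lemma extreme_point_of_edge:
  fixes Q :: "'a::euclidean_space set"
  assumes "polytope Q" "e edge_of Q" "v \<in> e" "v extreme_point_of Q"
  obtains u where "u \<noteq> v" "e = closed_segment v u"
proof -
  obtain p q where pq: "p \<noteq> q" "e = closed_segment p q"
    using edge_of_eq_segment assms by blast
  have "v extreme_point_of e"
    using assms extreme_point_of_face edge_of_def by blast
  then have "v = p \<or> v = q"
    using pq extreme_point_of_segment by blast
  then show ?thesis
    using pq that closed_segment_commute by metis
qed

lemma edge_of_extreme_point:
  assumes "closed_segment u v edge_of Q"
  shows "u extreme_point_of Q" "v extreme_point_of Q" "u \<noteq> v"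
proof -
  have *: "closed_segment u v face_of Q" "aff_dim (closed_segment u v) = 1"
    using assms by (auto simp: edge_of_def)
  then show "u \<noteq> v"
    by auto
  show "u extreme_point_of Q" "v extreme_point_of Q"
    using extreme_point_of_face[OF *(1)] extreme_point_of_segment by blast+
qed

text \<open>The extreme points of a slice close to \<open>v\<close> (the vertex figure) lie on the edges at \<open>v\<close>.\<close>

lemma polytope_subset_edge_cone:
  fixes Q :: "'a::euclidean_space set"
  assumes Q: "polytope Q" and v: "v extreme_point_of Q" and C: "convex_cone C"
    and edges: "\<And>u. closed_segment v u edge_of Q \<Longrightarrow> u - v \<in> C"
    and x: "x \<in> Q"
  shows "x - v \<in> C"
proof -
  have C0: "0 \<in> C"
    and Cscale: "\<And>c x. 0 \<le> c \<Longrightarrow> x \<in> C \<Longrightarrow> c *\<^sub>R x \<in> C"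
    using C by (auto simp: convex_cone_iff)
  have convC: "convex ((+) v ` C)"
    using C by (simp add: convex_cone_def)
  have poly: "polyhedron Q"
    using Q polytope_imp_polyhedron by blast
  have vQ: "v \<in> Q"
    using v by (simp add: extreme_point_of_def)
  define E where "E = {u. u extreme_point_of Q}"
  have finE: "finite E"
    unfolding E_def using finite_polyhedron_extreme_points[OF poly] .
  have QE: "Q = convex hull E"
    unfolding E_def
    using Krein_Milman_Minkowski[of Q] Q polytope_imp_compact polytope_imp_convex by blast
  have "{v} exposed_face_of Q"
    using v poly by (simp add: exposed_face_of_polyhedron face_of_singleton)
  then consider "Q = {v}" | a b where "Q \<subseteq> {x. a \<bullet> x \<le> b}" "{v} = Q \<inter> {x. a \<bullet> x = b}"
    unfolding exposed_face_of by blast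
  then show ?thesis
  proof cases
    case 1
    then show ?thesis
      using x C0 by simp
  next
    case (2 a b)
    have av: "a \<bullet> v = b"
      using 2 by blast
    have lt: "a \<bullet> u < b" if "u \<in> E - {v}" for u
    proof -
      have "u \<in> Q"
        using that by (auto simp: E_def extreme_point_of_def)
      then have "a \<bullet> u \<le> b" "a \<bullet> u \<noteq> b"
        using that 2 by auto
      then show ?thesis by simp
    qed
    \<comment> \<open>The highest level of a vertex other than \<open>v\<close>. The extra element
      \<open>b - 1\<close> keeps the set nonempty when there is no other vertex, and still lies
      below \<open>b\<close>. A level \<beta> between \<open>m\<close> and \<open>b\<close> then
      separates \<open>v\<close> from all other vertices.\<close>
    define m where "m = Max (insert (b - 1) ((\<bullet>) a ` (E - {v})))"
    have "m < b"
      unfolding m_def using finE lt by (subst Max_less_iff) auto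
    then obtain \<beta> where beta: "m < \<beta>" "\<beta> < b"
      using dense by blast
    have lt': "a \<bullet> u < \<beta>" if "u \<in> E - {v}" for u
    proof -
      have "a \<bullet> u \<le> m"
        unfolding m_def using finE that by (intro Max_ge) auto
      then show ?thesis using beta by simp
    qed
    define K where "K = Q \<inter> {y. a \<bullet> y = \<beta>}"
    have "polytope K"
      unfolding K_def using Q polytope_Int_polyhedron polyhedron_hyperplane by blast
    then have KE: "K = convex hull {y. y extreme_point_of K}"
      by (simp add: Krein_Milman_Minkowski polytope_imp_compact polytope_imp_convex)
    have "k \<in> (+) v ` C" if k: "k extreme_point_of K" for k
    proof -
      have kK: "k \<in> Q" "a \<bullet> k = \<beta>"
        using k by (auto simp: K_def extreme_point_of_def)
      obtain G where G: "G face_of Q" "k \<in> rel_interior G"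
        using polyhedron_face_rel_interior[OF poly kK(1)] .
      have kG: "k \<in> G"
        using G(2) rel_interior_subset by blast
      have "k extreme_point_of G \<inter> {y. a \<bullet> y = \<beta>}"
        using k kG kK face_of_imp_subset[OF G(1)] unfolding K_def extreme_point_of_def by blast
      then have "aff_dim G \<le> 1"
        using G(2) by (rule extreme_point_of_slice_aff_dim)
      moreover have "aff_dim G \<noteq> -1"
        using kG aff_dim_empty[of G] by auto
      \<comment> \<open>No vertex lies on level \<beta>: \<open>v\<close> is above it, all others
        are below. Hence the face around \<open>k\<close> is an edge.\<close>
      moreover have "aff_dim G \<noteq> 0"
      proof
        assume "aff_dim G = 0"
        then have "G = {k}"
          using kG by (auto simp: aff_dim_eq_0)
        then have "k \<in> E"
          using G by (simp add: E_def face_of_singleton)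
        then show False
          using lt'[of k] kK av beta by auto
      qed
      ultimately have "G edge_of Q"
        using G(1) aff_dim_geq[of G] by (simp add: edge_of_def)
      then obtain p q where pq: "G = closed_segment p q"
        using edge_of_eq_segment Q by blast
      \<comment> \<open>An edge avoiding \<open>v\<close> has both ends, hence all its points, below
        level \<beta>.\<close>
      have "v = p \<or> v = q"
      proof (rule ccontr)
        assume "\<not> (v = p \<or> v = q)"
        moreover have "p \<in> E" "q \<in> E"
          using edge_of_extreme_point \<open>G edge_of Q\<close> pq by (auto simp: E_def)
        ultimately have "closed_segment p q \<subseteq> {y. a \<bullet> y < \<beta>}"
          using lt' by (intro closed_segment_subset convex_halfspace_lt) auto
        then show False
          using kG kK pq by auto
      qed
      then obtain u where u: "G = closed_segment v u"
        using pq closed_segment_commute by metis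
      then obtain t where "0 \<le> t" "k = (1 - t) *\<^sub>R v + t *\<^sub>R u"
        using kG in_segment(1) by metis
      then have "k = v + t *\<^sub>R (u - v)"
        by (simp add: algebra_simps)
      moreover have "t *\<^sub>R (u - v) \<in> C"
        using \<open>G edge_of Q\<close> u edges Cscale \<open>0 \<le> t\<close> by blast
      ultimately show ?thesis by blast
    qed
    then have KC: "K \<subseteq> (+) v ` C"
      using convC by (subst KE) (rule hull_minimal, auto)
    have "u \<in> (+) v ` C" if u: "u \<in> E" for u
    proof (cases "u = v")
      case True
      then show ?thesis using C0 by force
    next
      case False
      then have au: "a \<bullet> u < \<beta>"
        using lt' u by blast
      \<comment> \<open>Chosen so that the point at parameter \<open>t\<close> on the segment from
        \<open>v\<close> to \<open>u\<close> has level \<beta> and so lies in \<open>K\<close>.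
        Rescaling by \<open>1 / t\<close> carries membership in the cone over to
        \<open>u - v\<close>.\<close>
      define t where "t = (b - \<beta>) / (b - a \<bullet> u)"
      have t: "0 < t" "t \<le> 1"
        using au beta by (auto simp: t_def field_simps)
      have "u \<in> Q"
        using u by (simp add: E_def extreme_point_of_def)
      then have "(1 - t) *\<^sub>R v + t *\<^sub>R u \<in> Q"
        using vQ t Q polytope_imp_convex convexD_alt by fastforce
      moreover have "t * (b - a \<bullet> u) = b - \<beta>"
        using au beta by (simp add: t_def)
      then have "a \<bullet> ((1 - t) *\<^sub>R v + t *\<^sub>R u) = \<beta>"
        by (simp add: inner_simps av algebra_simps)
      ultimately have "(1 - t) *\<^sub>R v + t *\<^sub>R u \<in> (+) v ` C"
        using KC by (auto simp: K_def)
      then obtain c where "c \<in> C" "v + c = (1 - t) *\<^sub>R v + t *\<^sub>R u"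
        by auto
      then have "c = t *\<^sub>R (u - v)"
        by (simp add: algebra_simps)
      then have "u - v = (1 / t) *\<^sub>R c"
        using t by simp
      then have "u - v \<in> C"
        using Cscale \<open>c \<in> C\<close> t by simp
      then show ?thesis
        by (metis add.commute diff_add_cancel image_eqI)
    qed
    then have "Q \<subseteq> (+) v ` C"
      using convC by (subst QE) (rule hull_minimal, auto)
    then show ?thesis
      using x by auto
  qed
qed

section \<open>Connectedness of the graph of a polytope\<close>

text \<open>This is the simplex step. If no edge at \<open>v\<close> increased \<open>a\<close>, all
  edge directions would lie in a half-space, which is a convex cone and would therefore contain
  \<open>x - v\<close>.\<close>

lemma polytope_improving_edge:
  fixes Q :: "'a::euclidean_space set"
  assumes "polytope Q" "v extreme_point_of Q" "x \<in> Q" "a \<bullet> v < a \<bullet> x"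
  obtains u where "closed_segment v u edge_of Q" "a \<bullet> v < a \<bullet> u"
proof (rule ccontr)
  assume "\<not> thesis"
  then have "\<And>u. closed_segment v u edge_of Q \<Longrightarrow> u - v \<in> {y. a \<bullet> y \<le> 0}"
    using that by (force simp: inner_diff_right)
  moreover have "convex_cone {y. a \<bullet> y \<le> 0}"
    by (simp add: convex_cone_iff inner_simps mult_nonneg_nonpos)
  ultimately have "x - v \<in> {y. a \<bullet> y \<le> 0}"
    using polytope_subset_edge_cone assms by blast
  then show False
    using assms by (simp add: inner_diff_right)
qed

text \<open>Take a linear functional that exposes \<open>t\<close>. From any other vertex an
  improving edge leads upwards, and the number of strictly higher vertices drops, so the climb ends
  at \<open>t\<close>.\<close>

lemma polytope_graph_connected:
  fixes Q :: "'a::euclidean_space set"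
  assumes Q: "polytope Q" and s: "s extreme_point_of Q" and t: "t extreme_point_of Q"
  shows "(s, t) \<in> {(x, y). closed_segment x y edge_of Q}\<^sup>*"
proof -
  let ?E = "{u. u extreme_point_of Q}"
  have poly: "polyhedron Q"
    using Q polytope_imp_polyhedron by blast
  have tQ: "t \<in> Q"
    using t by (simp add: extreme_point_of_def)
  have "{t} exposed_face_of Q"
    using t poly by (simp add: exposed_face_of_polyhedron face_of_singleton)
  then consider "Q = {t}" | a b where "Q \<subseteq> {x. a \<bullet> x \<le> b}" "{t} = Q \<inter> {x. a \<bullet> x = b}"
    unfolding exposed_face_of by blast
  then show ?thesis
  proof cases
    case 1
    then show ?thesis using s by simp
  next
    case (2 a b)
    show ?thesis
      using s
    proof (induction "card {u \<in> ?E. a \<bullet> s < a \<bullet> u}" arbitrary: s rule: less_induct)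
      case less
      show ?case
      proof (cases "s = t")
        case False
        have "s \<in> Q"
          using less.prems by (simp add: extreme_point_of_def)
        then have "a \<bullet> s \<le> b" "a \<bullet> s \<noteq> b" "a \<bullet> t = b"
          using 2 False by blast+
        then have "a \<bullet> s < a \<bullet> t"
          by simp
        then obtain u where u: "closed_segment s u edge_of Q" "a \<bullet> s < a \<bullet> u"
          using polytope_improving_edge Q less.prems tQ by blast
        then have uE: "u extreme_point_of Q"
          using edge_of_extreme_point by blast
        have "finite ?E"
          using finite_polyhedron_extreme_points[OF poly] .
        then have "card {w \<in> ?E. a \<bullet> u < a \<bullet> w} < card {w \<in> ?E. a \<bullet> s < a \<bullet> w}"
          using u uE by (intro psubset_card_mono) auto
        then have "(u, t) \<in> {(x, y). closed_segment x y edge_of Q}\<^sup>*"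
          using less.hyps uE by blast
        then show ?thesis
          using u by (auto intro: converse_rtrancl_into_rtrancl)
      qed simp
    qed
  qed
qed

section \<open>Edges and 2-faces at a vertex of a simple polytope\<close>

text \<open>By the edge cone property the edge directions at \<open>v\<close> span the translate of
  \<open>P\<close> by \<open>- v\<close>. Simplicity makes their number equal to the dimension, and
  a spanning set of that size is independent.\<close>

lemma simple_polytope_edges_independent:
  fixes P :: "'a::euclidean_space set"
  assumes P: "simple_polytope P" and v: "v extreme_point_of P"
  shows "independent ((\<lambda>u. u - v) ` {u. closed_segment v u edge_of P})" (is "independent ?B")
proof -
  let ?N = "{u. closed_segment v u edge_of P}"
  have poly: "polytope P"
    using P by (simp add: simple_polytope_def)
  have vP: "v \<in> P"
    using v by (simp add: extreme_point_of_def)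
  have "?N \<subseteq> {u. u extreme_point_of P}"
    using edge_of_extreme_point by blast
  then have finN: "finite ?N"
    using finite_polyhedron_extreme_points polytope_imp_polyhedron[OF poly] finite_subset by blast
  \<comment> \<open>Simplicity counts edges as sets, whereas the directions are indexed by the
    neighbours of \<open>v\<close>.\<close>
  have "bij_betw (closed_segment v) ?N {e. e edge_of P \<and> v \<in> e}"
    unfolding bij_betw_def
  proof
    show "inj_on (closed_segment v) ?N"
      by (rule inj_onI) (auto simp: closed_segment_eq doubleton_eq_iff)
    show "closed_segment v ` ?N = {e. e edge_of P \<and> v \<in> e}"
      using extreme_point_of_edge[OF poly _ _ v] by force
  qed
  then have "int (card ?N) = aff_dim P"
    using P v bij_betw_same_card by (fastforce simp: simple_polytope_def vertices_of_def)
  also have "\<dots> = int (dim ((+) (- v) ` P))"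
    using vP by (intro aff_dim_eq_dim hull_inc)
  finally have card: "card ?N = dim ((+) (- v) ` P)"
    by simp
  have "u \<in> P" if "u \<in> ?N" for u
    using edge_of_imp_subset that by fastforce
  then have sub: "?B \<subseteq> (+) (- v) ` P"
    by (auto simp: image_iff)
  have "y - v \<in> span ?B" if "y \<in> P" for y
  proof (rule polytope_subset_edge_cone[OF poly v _ _ that])
    show "convex_cone (span ?B)"
      by (simp add: convex_cone_iff span_zero span_add span_scale)
  qed (auto intro: span_base)
  then have "(+) (- v) ` P \<subseteq> span ?B"
    by auto
  then show ?thesis
    using card_le_dim_spanning[OF sub] finN card by (simp add: card_image inj_on_def)
qed

text \<open>Independence allows a linear functional that is 0 on the two given edge directions and
  -1 on all others. It supports \<open>P\<close> at \<open>v\<close>, and the face it cuts out is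
  \<open>G\<close>. The bound by the affine hull later forces \<open>G\<close> into every face
  containing the three vertices.\<close>

lemma simple_polytope_two_edges_face:
  fixes P :: "'a::euclidean_space set"
  assumes P: "simple_polytope P"
    and p: "closed_segment v p edge_of P" and q: "closed_segment v q edge_of P" and pq: "p \<noteq> q"
  obtains G where "G face_of P" "aff_dim G = 2" "{v, p, q} \<subseteq> G" "G \<subseteq> affine hull {v, p, q}"
proof -
  let ?N = "{u. closed_segment v u edge_of P}"
  let ?B = "(\<lambda>u. u - v) ` ?N"
  let ?S = "{p - v, q - v}"
  have poly: "polytope P"
    using P by (simp add: simple_polytope_def)
  have v: "v extreme_point_of P"
    using edge_of_extreme_point[OF p] by simp
  have ind: "independent ?B"
    using simple_polytope_edges_independent[OF P v] .
  obtain f :: "'a \<Rightarrow> real"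
    where f: "linear f" and fB: "\<And>x. x \<in> ?B \<Longrightarrow> f x = (if x \<in> ?S then 0 else -1)"
    using linear_independent_extend[OF ind, of "\<lambda>x. if x \<in> ?S then 0 else -1"] by blast
  have fadd: "f (x + y) = f x + f y" and fscale: "f (c *\<^sub>R x) = c * f x" for x y c
    using f by (auto simp: linear_add linear_scale)
  \<comment> \<open>The vector representing \<open>f\<close> as an inner product.\<close>
  define a where "a = adjoint f 1"
  have fa: "f x = a \<bullet> x" for x
    using adjoint_works[OF f, of x 1] by (simp add: a_def inner_commute)
  \<comment> \<open>The half-space alone would only give a supporting hyperplane. The second
    condition also controls where \<open>f\<close> vanishes; it survives addition because two
    nonpositive values with sum 0 are both 0.\<close>
  define C where "C = {x. f x \<le> 0 \<and> (f x = 0 \<longrightarrow> x \<in> span ?S)}"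
  have C: "convex_cone C"
    unfolding convex_cone_iff C_def
    by (auto simp: fadd fscale linear_0[OF f] span_zero span_scale mult_nonneg_nonpos
        intro!: span_add)
  have "u - v \<in> C" if "closed_segment v u edge_of P" for u
    using fB[of "u - v"] that by (auto simp: C_def span_base split: if_splits)
  then have PC: "x - v \<in> C" if "x \<in> P" for x
    using polytope_subset_edge_cone[OF poly v C] that by blast
  define G where "G = P \<inter> {x. a \<bullet> x = a \<bullet> v}"
  have "a \<bullet> x \<le> a \<bullet> v" if "x \<in> P" for x
    using PC[OF that] by (simp add: C_def fa inner_diff_right)
  then have face: "G face_of P"
    unfolding G_def using poly
    by (intro face_of_Int_supporting_hyperplane_le) (auto simp: polytope_imp_convex)
  have "f (p - v) = 0" "f (q - v) = 0"
    using fB p q by auto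
  moreover have "{v, p, q} \<subseteq> P"
    using edge_of_imp_subset[OF p] edge_of_imp_subset[OF q] by auto
  ultimately have sub: "{v, p, q} \<subseteq> G"
    by (auto simp: G_def fa inner_diff_right)
  have "G \<subseteq> (+) v ` span ?S"
  proof
    fix x assume x: "x \<in> G"
    then have "x - v \<in> span ?S"
      using PC[of x] by (auto simp: G_def C_def fa inner_diff_right)
    then show "x \<in> (+) v ` span ?S"
      by (metis add.commute diff_add_cancel image_eqI)
  qed
  also have "\<dots> = affine hull {v, p, q}"
    using affine_hull_insert_span_gen[of v "{p, q}"] by simp
  finally have hull: "G \<subseteq> affine hull {v, p, q}" .
  have "independent ?S"
    using independent_mono[OF ind] p q by auto
  then have "dim ?S = 2"
    using pq by (simp add: dim_eq_card_independent)
  then have "aff_dim {v, p, q} = 2"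
    using aff_dim_eq_dim[of v "{v, p, q}"] dim_span[of "insert 0 ?S"] dim_span[of ?S]
    by (simp add: hull_inc span_insert_0)
  then have "aff_dim G = 2"
    using aff_dim_subset[OF sub] aff_dim_subset[OF hull] by simp
  with face sub hull that show ?thesis by blast
qed

section \<open>Lifting walks above a given level\<close>

text \<open>Walks are pushed upwards level by level: a visit to a lowest vertex is bypassed above it.\<close>

lemma rtrancl_above_level:
  fixes f :: "'a \<Rightarrow> nat"
  assumes neq: "\<And>x y. (x, y) \<in> R \<Longrightarrow> f x \<noteq> f y"
    and sym: "sym R"
    and bypass: "\<And>w x y. \<lbrakk>(w, x) \<in> R; (w, y) \<in> R; f w < f x; f w < f y\<rbrakk>
      \<Longrightarrow> (x, y) \<in> (R \<inter> {z. f w < f z} \<times> {z. f w < f z})\<^sup>*"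
    and st: "(s, t) \<in> R\<^sup>*" "k \<le> f s" "k \<le> f t"
  shows "(s, t) \<in> (R \<inter> {z. k \<le> f z} \<times> {z. k \<le> f z})\<^sup>*"
  using st(2,3)
proof (induction k)
  case 0
  then show ?case using st(1) by simp
next
  case (Suc k)
  let ?R = "R \<inter> {z. k \<le> f z} \<times> {z. k \<le> f z}"
  let ?R' = "R \<inter> {z. Suc k \<le> f z} \<times> {z. Suc k \<le> f z}"
  have "(s, t) \<in> ?R\<^sup>*"
    using Suc by simp
  \<comment> \<open>A walk prefix ending on level \<open>k\<close> cannot be a walk in
    \<open>?R'\<close>. The invariant therefore records that every higher neighbour of such an
    endpoint is already reachable in \<open>?R'\<close>.\<close>
  then have "(k < f t \<longrightarrow> (s, t) \<in> ?R'\<^sup>*) \<and>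
    (f t = k \<longrightarrow> (\<forall>y. (t, y) \<in> R \<longrightarrow> k < f y \<longrightarrow> (s, y) \<in> ?R'\<^sup>*))"
  proof induction
    case base
    then show ?case using Suc.prems by auto
  next
    case (step x y)
    then have xy: "(x, y) \<in> R" "(y, x) \<in> R" "k \<le> f x" "k \<le> f y" "f x \<noteq> f y"
      using neq symD[OF sym] by auto
    show ?case
    proof (cases "f x = k")
      case True
      then show ?thesis using step.IH xy by auto
    next
      case False
      then have x: "k < f x" "(s, x) \<in> ?R'\<^sup>*"
        using xy step.IH by auto
      show ?thesis
      proof (cases "f y = k")
        case True
        \<comment> \<open>The walk came to \<open>y\<close> from the higher vertex \<open>x\<close>;
          the detour leads from \<open>x\<close> to \<open>z\<close> without visiting
          \<open>y\<close>.\<close>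
        have "(s, z) \<in> ?R'\<^sup>*" if "(y, z) \<in> R" "k < f z" for z
          using bypass[of y x z] that xy x True by (auto simp: Suc_le_eq)
        then show ?thesis using True by auto
      next
        case False
        then have "(x, y) \<in> ?R'"
          using xy x by auto
        then show ?thesis
          using x False by (auto intro: rtrancl_into_rtrancl)
      qed
    qed
  qed
  then show ?case using Suc.prems by simp
qed

section \<open>Orientations, sinks and ascending paths on faces\<close>

lemma graph_edges_iff: "{u, v} \<in> graph_edges P \<longleftrightarrow> closed_segment u v edge_of P"
  unfolding graph_edges_def by (auto simp: doubleton_eq_iff closed_segment_commute)

lemma vertices_of_face: "F face_of P \<Longrightarrow> vertices_of F = vertices_of P \<inter> F"
  by (auto simp: vertices_of_def extreme_point_of_face)

text \<open>A segment with both ends in \<open>F\<close> lies in \<open>F\<close> by convexity. So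
  the subgraph induced by the vertices of \<open>F\<close> is the graph of \<open>F\<close> itself,
  and sinks can be studied inside \<open>F\<close>.\<close>

lemma edge_of_face_iff:
  assumes "F face_of P"
  shows "closed_segment u v edge_of F \<longleftrightarrow>
    closed_segment u v edge_of P \<and> u \<in> vertices_of F \<and> v \<in> vertices_of F"
proof
  assume "closed_segment u v edge_of F"
  then show "closed_segment u v edge_of P \<and> u \<in> vertices_of F \<and> v \<in> vertices_of F"
    using edge_of_extreme_point[of u v F] assms face_of_trans
    by (auto simp: vertices_of_def edge_of_def)
next
  assume *: "closed_segment u v edge_of P \<and> u \<in> vertices_of F \<and> v \<in> vertices_of F"
  then have "closed_segment u v \<subseteq> F"
    using assms by (intro closed_segment_subset)
      (auto simp: vertices_of_def extreme_point_of_def face_of_imp_convex)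
  then show "closed_segment u v edge_of F"
    using * assms face_of_face by (auto simp: edge_of_def)
qed

lemma sink_on_iff:
  assumes "F face_of P"
  shows "sink_on P D F v \<longleftrightarrow>
    v \<in> vertices_of F \<and> (\<forall>u. closed_segment v u edge_of F \<longrightarrow> (u, v) \<in> D)"
  unfolding sink_on_def induced_edges_def edge_of_face_iff[OF assms]
  by (auto simp: graph_edges_iff closed_segment_commute)

lemma acyclic_orientation_edge:
  assumes "acyclic_orientation P D"
  shows "closed_segment u v edge_of P \<longleftrightarrow> (u, v) \<in> D \<or> (v, u) \<in> D"
proof -
  have "\<And>u v. (u, v) \<in> D \<Longrightarrow> {u, v} \<in> graph_edges P"
    and "\<And>u v. {u, v} \<in> graph_edges P \<Longrightarrow> (u, v) \<in> D \<or> (v, u) \<in> D"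
    using assms unfolding acyclic_orientation_def orientation_of_def by blast+
  then show ?thesis
    unfolding graph_edges_iff using closed_segment_commute by metis
qed

lemma finite_acyclic_orientation:
  fixes P :: "'a::euclidean_space set"
  assumes "polytope P" "acyclic_orientation P D"
  shows "finite D"
proof (rule finite_subset)
  show "D \<subseteq> {u. u extreme_point_of P} \<times> {u. u extreme_point_of P}"
  proof (clarify, intro conjI)
    fix u v assume "(u, v) \<in> D"
    then have "closed_segment u v edge_of P"
      using acyclic_orientation_edge[OF assms(2), of u v] by simp
    then show "u \<in> {u. u extreme_point_of P}" "v \<in> {u. u extreme_point_of P}"
      using edge_of_extreme_point[of u v P] by simp_all
  qed
  show "finite ({u. u extreme_point_of P} \<times> {u. u extreme_point_of P})"
    using assms(1) by (simp add: finite_polyhedron_extreme_points polytope_imp_polyhedron)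
qed

text \<open>The rank of a vertex is its number of proper predecessors. Along an edge from
  \<open>u\<close> to \<open>v\<close> this set grows strictly: \<open>u\<close> is new, as
  acyclicity keeps it from preceding itself.\<close>

lemma finite_acyclic_rank:
  assumes "finite D" "acyclic D"
  obtains f :: "'a \<Rightarrow> nat" where "\<And>u v. (u, v) \<in> D \<Longrightarrow> f u < f v"
proof
  fix u v assume uv: "(u, v) \<in> D"
  have "finite {w. (w, v) \<in> D\<^sup>+}"
    by (rule finite_subset[of _ "fst ` D\<^sup>+"]) (use assms in force)+
  moreover have "{w. (w, u) \<in> D\<^sup>+} \<subset> {w. (w, v) \<in> D\<^sup>+}"
    using uv assms(2) by (auto simp: acyclic_def intro: trancl_into_trancl)
  ultimately show "card {w. (w, u) \<in> D\<^sup>+} < card {w. (w, v) \<in> D\<^sup>+}"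
    by (rule psubset_card_mono)
qed

text \<open>A vertex of \<open>G\<close> that is not a sink has an outgoing edge in
  \<open>G\<close>, and following such edges must stop because the converse of \<open>D\<close> is
  well-founded. This yields both the existence of sinks and the ascending paths used for
  detours.\<close>

lemma acyclic_orientation_reaches_sink:
  fixes P :: "'a::euclidean_space set"
  assumes P: "polytope P" and D: "acyclic_orientation P D"
    and G: "G face_of P" and v: "v \<in> vertices_of G"
  obtains z where "sink_on P D G z" "(v, z) \<in> (D \<inter> {(x, y). closed_segment x y edge_of G})\<^sup>*"
proof -
  let ?R = "D \<inter> {(x, y). closed_segment x y edge_of G}"
  have "wf (D\<inverse>)"
    using finite_acyclic_orientation[OF P D] D
    by (simp add: finite_acyclic_wf_converse acyclic_orientation_def)
  then have "\<exists>z. sink_on P D G z \<and> (v, z) \<in> ?R\<^sup>*"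
    using v
  proof (induction v rule: wf_induct_rule)
    case (less v)
    show ?case
    proof (cases "sink_on P D G v")
      case False
      then obtain u where u: "closed_segment v u edge_of G" "(u, v) \<notin> D"
        using less.prems sink_on_iff[OF G] by blast
      then have "(v, u) \<in> D" "u \<in> vertices_of G"
        using acyclic_orientation_edge[OF D] edge_of_face_iff[OF G] by blast+
      then obtain z where "sink_on P D G z" "(u, z) \<in> ?R\<^sup>*"
        using less.IH by blast
      moreover have "(v, u) \<in> ?R"
        using u \<open>(v, u) \<in> D\<close> by simp
      ultimately show ?thesis
        by (blast intro: converse_rtrancl_into_rtrancl)
    qed auto
  qed
  with that show ?thesis by blast
qed

text \<open>Values only grow along the walk, so the strict bound at its start persists. This keeps a
  detour above the vertex it avoids.\<close>

lemma rtrancl_ascending: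
  fixes f :: "'a \<Rightarrow> 'b::order"
  assumes "(x, z) \<in> R\<^sup>*" and up: "\<And>u v. (u, v) \<in> R \<Longrightarrow> f u < f v" and "c < f x"
  shows "(x, z) \<in> (R \<inter> {y. c < f y} \<times> {y. c < f y})\<^sup>* \<and> c < f z"
  using assms(1)
proof induction
  case (step y z)
  then have "(y, z) \<in> R \<inter> {y. c < f y} \<times> {y. c < f y}"
    using up[of y z] by auto
  with step show ?case
    by (auto intro: rtrancl_into_rtrancl)
qed (use assms in auto)

text \<open>Two outgoing edges at \<open>w\<close> span a 2-face, and ascending paths inside it from both upper
  endpoints end in its only sink.\<close>

lemma bypass_in_face:
  fixes P :: "'a::euclidean_space set"
  assumes P: "simple_polytope P" and D: "acyclic_orientation P D"
    and uniq: "\<And>G. G face_of P \<Longrightarrow> aff_dim G = 2 \<Longrightarrow> \<exists>!v. sink_on P D G v"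
    and up: "\<And>u v. (u, v) \<in> D \<Longrightarrow> f u < (f v :: nat)"
    and F: "F face_of P"
    and wx: "closed_segment w x edge_of F" "f w < f x"
    and wy: "closed_segment w y edge_of F" "f w < f y"
  shows "(x, y) \<in> ({(x, y). closed_segment x y edge_of F} \<inter> {z. f w < f z} \<times> {z. f w < f z})\<^sup>*"
    (is "_ \<in> ?S\<^sup>*")
proof (cases "x = y")
  case False
  have poly: "polytope P"
    using P by (simp add: simple_polytope_def)
  have edges: "closed_segment w x edge_of P" "closed_segment w y edge_of P"
    and vF: "w \<in> vertices_of F" "x \<in> vertices_of F" "y \<in> vertices_of F"
    using wx wy edge_of_face_iff[OF F] by auto
  then obtain G where G: "G face_of P" "aff_dim G = 2" "{w, x, y} \<subseteq> G"
    and hull: "G \<subseteq> affine hull {w, x, y}"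
    using simple_polytope_two_edges_face[OF P _ _ False] by blast
  have "{w, x, y} \<subseteq> F"
    using vF by (auto simp: vertices_of_face[OF F])
  \<comment> \<open>\<open>G\<close> was built as a face of \<open>P\<close>. It lies in
    \<open>F\<close> because it lies in the plane of three vertices of \<open>F\<close>, and
    \<open>F\<close> is the intersection of \<open>P\<close> with its own affine hull.\<close>
  then have "G \<subseteq> affine hull F \<inter> P"
    using hull hull_mono[of "{w, x, y}" F affine] face_of_imp_subset[OF G(1)] by blast
  then have "G \<subseteq> F"
    using face_of_imp_eq_affine_Int[OF _ F] poly polytope_imp_convex by blast
  then have "G face_of F"
    using G(1) F face_of_face by blast
  define R where "R = D \<inter> {(x, y). closed_segment x y edge_of G}"
  have climb: "\<exists>z. sink_on P D G z \<and> (u, z) \<in> ?S\<^sup>*" if "u \<in> {x, y}" for u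
  proof -
    have "u \<in> vertices_of G"
      using that G vF by (auto simp: vertices_of_face[OF G(1)] vertices_of_face[OF F])
    then obtain z where z: "sink_on P D G z" "(u, z) \<in> R\<^sup>*"
      using acyclic_orientation_reaches_sink[OF poly D G(1)] R_def by blast
    have "(u, z) \<in> (R \<inter> {z. f w < f z} \<times> {z. f w < f z})\<^sup>*"
      using rtrancl_ascending[OF z(2), of f "f w"] up that wx wy by (auto simp: R_def)
    moreover have "R \<inter> {z. f w < f z} \<times> {z. f w < f z} \<subseteq> ?S"
      using edge_of_face_iff[OF \<open>G face_of F\<close>] by (auto simp: R_def)
    ultimately show ?thesis
      using z(1) rtrancl_mono by blast
  qed
  \<comment> \<open>The sinks reached from \<open>x\<close> and from \<open>y\<close> coincide,
    since the 2-face \<open>G\<close> has only one.\<close>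
  then obtain z where "(x, z) \<in> ?S\<^sup>*" "(y, z) \<in> ?S\<^sup>*"
    using uniq[OF G(1,2)] by blast
  moreover have "sym ?S"
    by (auto simp: sym_def closed_segment_commute)
  ultimately show ?thesis
    by (meson rtrancl_trans symD sym_rtrancl)
qed simp

section \<open>Uniqueness of the sink on every face\<close>

theorem theorem5:
  fixes P :: "'a::euclidean_space set" and D :: "('a \<times> 'a) set"
  assumes "simple_polytope P"
    and "acyclic_orientation P D"
    and "\<And>F. F face_of P \<Longrightarrow> aff_dim F = 2 \<Longrightarrow> \<exists>!v. sink_on P D F v"
  shows "AOF_orientation P D"
proof -
  note D = assms(2)
  have poly: "polytope P"
    using assms(1) by (simp add: simple_polytope_def)
  obtain f :: "'a \<Rightarrow> nat" where up: "\<And>u v. (u, v) \<in> D \<Longrightarrow> f u < f v"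
    using finite_acyclic_rank[OF finite_acyclic_orientation[OF poly D]] D
      acyclic_orientation_def by blast
  have "\<exists>!v. sink_on P D F v" if F: "F face_of P" "F \<noteq> {}" for F
  proof -
    have polyF: "polytope F"
      using F poly face_of_polytope_polytope by blast
    obtain v where "v extreme_point_of F"
      using extreme_point_exists_convex[of F] polyF F
        polytope_imp_compact polytope_imp_convex by blast
    then obtain z where z: "sink_on P D F z"
      using acyclic_orientation_reaches_sink[OF poly D F(1), of v] by (auto simp: vertices_of_def)
    let ?R = "{(x, y). closed_segment x y edge_of F}"
    \<comment> \<open>By symmetry it suffices to treat two sinks with \<open>s\<close> the lower one
      in rank.\<close>
    have eq: "s = t" if s: "sink_on P D F s" and t: "sink_on P D F t" and st: "f s \<le> f t" for s t
    proof -
      have "(s, t) \<in> ?R\<^sup>*"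
        using polytope_graph_connected[OF polyF] s t sink_on_iff[OF F(1)]
        by (auto simp: vertices_of_def)
      moreover have "f x \<noteq> f y" if "(x, y) \<in> ?R" for x y
        using that up edge_of_face_iff[OF F(1)] acyclic_orientation_edge[OF D, of x y] by fastforce
      moreover have "sym ?R"
        by (auto simp: sym_def closed_segment_commute)
      moreover have "(x, y) \<in> (?R \<inter> {z. f w < f z} \<times> {z. f w < f z})\<^sup>*"
        if "(w, x) \<in> ?R" "(w, y) \<in> ?R" "f w < f x" "f w < f y" for w x y
        using bypass_in_face[OF assms up F(1)] that by simp
      ultimately have "(s, t) \<in> (?R \<inter> {z. f s \<le> f z} \<times> {z. f s \<le> f z})\<^sup>*"
        using st by (intro rtrancl_above_level) auto
      then show ?thesis
      proof (cases rule: converse_rtranclE)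
        case (step y)
        \<comment> \<open>A first step of the lifted walk would lead to a neighbour \<open>y\<close>
          of the sink \<open>s\<close>. Its edge points to \<open>s\<close>, so \<open>y\<close> has
          smaller rank, against the level bound.\<close>
        then have "f y < f s"
          using up s sink_on_iff[OF F(1)] by blast
        with step show ?thesis by simp
      qed
    qed
    show ?thesis
      using z eq nat_le_linear by metis
  qed
  then show ?thesis
    using D by (simp add: AOF_orientation_def)
qed

end
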